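(* Let $D=\mathbb{Z}[\omega]$ with $\omega=\frac{-1+i\sqrt{3}}{2}$, and let $\pi\in D$ be a prime with $N\pi\neq 3$. Then $$\chi_\pi(\omega)=\omega^{\frac{N\pi-1}{3}}=\begin{cases}1 & \text{if } N\pi\equiv 1\pmod 9,\\ \omega & \text{if } N\pi\equiv 4\pmod 9,\\ \omega^2 & \text{if } N\pi\equiv 7\pmod 9.\end{cases}$$
   Context: For $\alpha=a+b\omega\in D$ with $a,b\in\mathbb{Z}$, the norm is $N\alpha=\alpha\overline{\alpha}=a^2-ab+b^2$. For a prime $\pi\in D$ with $N\pi\ne 3$, the cubic residue character $\chi_\pi$ on $D$ is defined by: $\chi_\pi(\alpha)=0$ if $\pi\mid\alpha$; otherwise $\chi_\pi(\alpha)$ is the unique element of $\{1,\omega,\omega^2\}$ with $\alpha^{(N\pi-1)/3}\equiv\chi_\pi(\alpha)\pmod{\pi}$. *)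

theory Defs
  imports Complex_Main "HOL-Computational_Algebra.Primes" "HOL-Number_Theory.Cong"
begin

definition omega_complex :: complex where
  "omega_complex = (-1 + \<i> * of_real (sqrt 3)) / 2"

lemma omega_complex_sq: "omega_complex * omega_complex = -1 - omega_complex"
  by (simp add: omega_complex_def complex_eq_iff field_simps)

lemma cnj_omega_complex: "cnj omega_complex = -1 - omega_complex"
  by (simp add: omega_complex_def complex_eq_iff field_simps)

definition eisenstein_integers :: "complex set" where
  "eisenstein_integers = {of_int a + of_int b * omega_complex | a b. True}"

lemma eisenstein_integersI:
  "z = of_int a + of_int b * omega_complex \<Longrightarrow> z \<in> eisenstein_integers"
  by (auto simp: eisenstein_integers_def)

lemma eisenstein_integersE:
  assumes "z \<in> eisenstein_integers"
  obtains a b where "z = of_int a + of_int b * omega_complex"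
  using assms by (auto simp: eisenstein_integers_def)

text \<open>
  The ring \<open>D\<close> is a type of its own, so that the library's class-based
  divisibility and prime elements (\<open>dvd\<close>, \<open>prime_elem\<close>) mean divisibility and
  primality in \<open>D\<close>; in the field \<open>complex\<close> both would be degenerate.
\<close>

typedef eisenstein = eisenstein_integers
  by (rule exI[of _ 0], rule eisenstein_integersI[of _ 0 0]) simp

setup_lifting type_definition_eisenstein

instantiation eisenstein :: idom
begin

lift_definition zero_eisenstein :: eisenstein is 0
  by (rule eisenstein_integersI[of _ 0 0]) simp

lift_definition one_eisenstein :: eisenstein is 1
  by (rule eisenstein_integersI[of _ 1 0]) simp

lift_definition plus_eisenstein :: "eisenstein \<Rightarrow> eisenstein \<Rightarrow> eisenstein" is "(+)"
proof (elim eisenstein_integersE)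
  fix z w :: complex and a b c d :: int
  assume "z = of_int a + of_int b * omega_complex" "w = of_int c + of_int d * omega_complex"
  then show "z + w \<in> eisenstein_integers"
    by (intro eisenstein_integersI[of _ "a + c" "b + d"]) (simp add: algebra_simps)
qed

lift_definition uminus_eisenstein :: "eisenstein \<Rightarrow> eisenstein" is uminus
proof (elim eisenstein_integersE)
  fix z :: complex and a b :: int
  assume "z = of_int a + of_int b * omega_complex"
  then show "- z \<in> eisenstein_integers"
    by (intro eisenstein_integersI[of _ "- a" "- b"]) simp
qed

lift_definition minus_eisenstein :: "eisenstein \<Rightarrow> eisenstein \<Rightarrow> eisenstein" is "(-)"
proof (elim eisenstein_integersE)
  fix z w :: complex and a b c d :: int
  assume "z = of_int a + of_int b * omega_complex" "w = of_int c + of_int d * omega_complex"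
  then show "z - w \<in> eisenstein_integers"
    by (intro eisenstein_integersI[of _ "a - c" "b - d"]) (simp add: algebra_simps)
qed

lift_definition times_eisenstein :: "eisenstein \<Rightarrow> eisenstein \<Rightarrow> eisenstein" is "(*)"
proof (elim eisenstein_integersE)
  fix z w :: complex and a b c d :: int
  assume "z = of_int a + of_int b * omega_complex" "w = of_int c + of_int d * omega_complex"
  then have "z * w = of_int (a * c) + of_int (a * d + b * c) * omega_complex
      + of_int (b * d) * (omega_complex * omega_complex)"
    by (simp add: algebra_simps)
  then show "z * w \<in> eisenstein_integers"
    unfolding omega_complex_sq
    by (intro eisenstein_integersI[of _ "a * c - b * d" "a * d + b * c - b * d"])
       (simp add: algebra_simps)
qed

instance
  by standard (transfer; simp add: algebra_simps)+

end

lift_definition omega :: eisenstein is omega_complex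
  by (rule eisenstein_integersI[of _ 0 1]) simp

lift_definition eis_cnj :: "eisenstein \<Rightarrow> eisenstein" is cnj
proof (elim eisenstein_integersE)
  fix z :: complex and a b :: int
  assume "z = of_int a + of_int b * omega_complex"
  then show "cnj z \<in> eisenstein_integers"
    by (intro eisenstein_integersI[of _ "a - b" "- b"]) (simp add: cnj_omega_complex algebra_simps)
qed

lemma Rep_eisenstein_of_nat: "Rep_eisenstein (of_nat n) = of_nat n"
  by (induction n) (simp_all add: zero_eisenstein.rep_eq one_eisenstein.rep_eq plus_eisenstein.rep_eq)

lemma Rep_eisenstein_of_int: "Rep_eisenstein (of_int k) = of_int k"
  by (cases k rule: int_diff_cases)
     (simp add: minus_eisenstein.rep_eq Rep_eisenstein_of_nat)

instance eisenstein :: ring_char_0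
proof
  show "inj (of_nat :: nat \<Rightarrow> eisenstein)"
    by (rule injI) (metis Rep_eisenstein_of_nat of_nat_eq_iff)
qed

lemma eisenstein_cases:
  obtains a b where "\<alpha> = of_int a + of_int b * omega"
proof -
  obtain a b where "Rep_eisenstein \<alpha> = of_int a + of_int b * omega_complex"
    using Rep_eisenstein[of \<alpha>] by (elim eisenstein_integersE)
  then have "Rep_eisenstein \<alpha> = Rep_eisenstein (of_int a + of_int b * omega)"
    by (simp add: plus_eisenstein.rep_eq times_eisenstein.rep_eq omega.rep_eq Rep_eisenstein_of_int)
  then show thesis
    using that by (simp add: Rep_eisenstein_inject)
qed

text \<open>The norm as a rational integer; \<open>eis_norm_eq\<close> below is the formula in coordinates.\<close>

definition eis_norm :: "eisenstein \<Rightarrow> int" where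
  "eis_norm \<alpha> = (THE n. of_int n = \<alpha> * eis_cnj \<alpha>)"

lemma eis_mult_cnj:
  "(of_int a + of_int b * omega) * eis_cnj (of_int a + of_int b * omega) = of_int (a^2 - a * b + b^2)"
proof -
  have "Rep_eisenstein ((of_int a + of_int b * omega) * eis_cnj (of_int a + of_int b * omega))
      = (of_int a + of_int b * omega_complex) * (of_int a + of_int b * (-1 - omega_complex))"
    by (simp add: plus_eisenstein.rep_eq times_eisenstein.rep_eq omega.rep_eq eis_cnj.rep_eq
        Rep_eisenstein_of_int cnj_omega_complex)
  also have "\<dots> = of_int (a^2 - a * b) - of_int (b^2) * (omega_complex + omega_complex * omega_complex)"
    by (simp add: algebra_simps power2_eq_square)
  also have "\<dots> = Rep_eisenstein (of_int (a^2 - a * b + b^2))"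
    by (simp only: omega_complex_sq Rep_eisenstein_of_int) simp
  finally show ?thesis
    by (simp only: Rep_eisenstein_inject)
qed

lemma eis_norm_eq: "eis_norm (of_int a + of_int b * omega) = a^2 - a * b + b^2"
  unfolding eis_norm_def eis_mult_cnj of_int_eq_iff by simp

lemma of_int_eis_norm: "of_int (eis_norm \<alpha>) = \<alpha> * eis_cnj \<alpha>"
  by (cases \<alpha> rule: eisenstein_cases) (simp only: eis_norm_eq eis_mult_cnj)

text \<open>
  Intended for prime \<open>\<pi>\<close> with \<open>eis_norm \<pi> \<noteq> 3\<close>; then \<open>eis_norm \<pi> \<equiv> 1\<close> modulo \<open>3\<close>, so the
  division in the exponent is exact, and the described element is unique.
\<close>

definition cubic_residue_char :: "eisenstein \<Rightarrow> eisenstein \<Rightarrow> eisenstein" where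
  "cubic_residue_char \<pi> \<alpha> =
    (if \<pi> dvd \<alpha> then 0
     else (THE \<zeta>. \<zeta> \<in> {1, omega, omega^2} \<and> \<pi> dvd (\<alpha> ^ nat ((eis_norm \<pi> - 1) div 3) - \<zeta>)))"

end

theory Submission
  imports Defs
begin

text \<open>
  The associates of \<open>1 - \<omega>\<close> are exactly the primes of norm \<open>3\<close>, so \<open>\<pi>\<close> does not divide \<open>1 - \<omega>\<close>.
  Hence the cube roots of unity are pairwise incongruent modulo \<open>\<pi>\<close>, and the power
  \<open>\<omega> ^ ((N \<pi> - 1) / 3)\<close>, itself a cube root of unity, is the value of the character. As
  \<open>a + b \<omega> = (a + b) - b (1 - \<omega>)\<close> and \<open>N (a + b \<omega>) \<equiv> (a + b)\<^sup>2\<close> modulo \<open>3\<close>, not being divisible by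
  \<open>1 - \<omega>\<close> forces \<open>N \<pi> \<equiv> 1\<close> modulo \<open>3\<close>; the residue of \<open>N \<pi>\<close> modulo \<open>9\<close> then determines the
  exponent modulo \<open>3\<close>.
\<close>

lemma omega_square: "omega ^ 2 = - 1 - omega"
  unfolding power2_eq_square by transfer (rule omega_complex_sq)

lemma omega_cube: "omega ^ 3 = 1"
proof -
  have "omega ^ 3 = omega * omega ^ 2"
    by (simp add: power3_eq_cube power2_eq_square)
  also have "\<dots> = - omega - omega ^ 2"
    by (simp add: omega_square right_diff_distrib flip: power2_eq_square)
  finally show ?thesis
    by (simp add: omega_square)
qed

lemma omega_power_mod_3: "omega ^ n = omega ^ (n mod 3)"
proof -
  have "omega ^ n = omega ^ (3 * (n div 3) + n mod 3)"
    by simp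
  then show ?thesis
    by (simp only: power_add power_mult omega_cube power_one mult_1)
qed

lemma omega_power_in: "omega ^ n \<in> {1, omega, omega ^ 2}"
proof -
  have "n mod 3 = 0 \<or> n mod 3 = 1 \<or> n mod 3 = 2"
    by linarith
  then show ?thesis
    unfolding omega_power_mod_3[of n] by auto
qed

lemma eis_cnj_mult: "eis_cnj (\<alpha> * \<beta>) = eis_cnj \<alpha> * eis_cnj \<beta>"
  by transfer simp

text \<open>The norm is specified through its image in the ring, so the identity is checked there
  and pulled back along the injective \<open>of_int\<close>.\<close>

lemma eis_norm_mult: "eis_norm (\<alpha> * \<beta>) = eis_norm \<alpha> * eis_norm \<beta>"
proof -
  have "(of_int (eis_norm (\<alpha> * \<beta>)) :: eisenstein) = of_int (eis_norm \<alpha> * eis_norm \<beta>)"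
    by (simp add: of_int_eis_norm eis_cnj_mult mult_ac)
  then show ?thesis
    by (simp only: of_int_eq_iff)
qed

lemma eis_norm_nonneg: "eis_norm \<alpha> \<ge> 0"
proof (cases \<alpha> rule: eisenstein_cases)
  case (1 a b)
  have "4 * eis_norm \<alpha> = (2 * a - b)^2 + 3 * b^2"
    unfolding 1 eis_norm_eq by (simp add: power2_eq_square algebra_simps)
  then show ?thesis
    by (smt (verit) zero_le_power2)
qed

lemma eis_norm_1: "eis_norm 1 = 1"
  using eis_norm_eq[of 1 0] by simp

lemma eis_norm_one_minus_omega: "eis_norm (1 - omega) = 3"
  using eis_norm_eq[of 1 "- 1"] by simp

lemma eis_norm_dvd:
  assumes "\<alpha> dvd \<beta>"
  shows "eis_norm \<alpha> dvd eis_norm \<beta>"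
  using assms by (auto simp: eis_norm_mult elim!: dvdE)

text \<open>The conjugate is then an inverse.\<close>

lemma eis_norm_eq_1_imp_unit:
  assumes "eis_norm \<alpha> = 1"
  shows "\<alpha> dvd 1"
  using of_int_eis_norm[of \<alpha>] assms by (metis dvd_triv_left of_int_1)

lemma one_minus_omega_dvd_iff: "1 - omega dvd \<alpha> \<longleftrightarrow> 3 dvd eis_norm \<alpha>"
proof
  show "1 - omega dvd \<alpha> \<Longrightarrow> 3 dvd eis_norm \<alpha>"
    using eis_norm_dvd eis_norm_one_minus_omega by metis
next
  assume "3 dvd eis_norm \<alpha>"
  obtain a b where \<alpha>: "\<alpha> = of_int a + of_int b * omega"
    by (rule eisenstein_cases)
  have "eis_norm \<alpha> = (a + b)^2 - 3 * (a * b)"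
    unfolding \<alpha> eis_norm_eq by (simp add: power2_eq_square algebra_simps)
  with \<open>3 dvd eis_norm \<alpha>\<close> have "3 dvd (a + b)^2"
    by presburger
  then have "3 dvd a + b"
    by (rule prime_dvd_power_int[rotated]) simp
  then obtain c where "a + b = 3 * c" ..
  then have "\<alpha> = 3 * of_int c - of_int b * (1 - omega)"
    unfolding \<alpha> by (simp add: algebra_simps flip: of_int_add)
  \<comment> \<open>The cofactor is the conjugate \<open>1 - omega ^ 2\<close> of
    \<open>1 - omega\<close>.\<close>
  moreover have "3 = (1 - omega) * (2 + omega)"
    using omega_square by (simp add: algebra_simps power2_eq_square)
  then have "1 - omega dvd 3"
    by (rule dvdI)
  ultimately show "1 - omega dvd \<alpha>"
    by simp
qed

lemma prime_elem_not_dvd_one_minus_omega: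
  assumes "prime_elem \<pi>" and "eis_norm \<pi> \<noteq> 3"
  shows "\<not> \<pi> dvd 1 - omega"
proof
  assume "\<pi> dvd 1 - omega"
  then have "eis_norm \<pi> dvd 3"
    using eis_norm_dvd eis_norm_one_minus_omega by metis
  moreover have "prime (3 :: int)"
    by simp
  ultimately have "eis_norm \<pi> = 1"
    using assms(2) eis_norm_nonneg[of \<pi>] by (auto simp: prime_int_iff)
  with assms(1) show False
    using eis_norm_eq_1_imp_unit prime_elem_not_unit by blast
qed

lemma prime_elem_norm_mod_3:
  assumes "prime_elem \<pi>" and "eis_norm \<pi> \<noteq> 3"
  shows "eis_norm \<pi> mod 3 = 1"
proof -
  have "\<not> 1 - omega dvd \<pi>"
  proof
    assume "1 - omega dvd \<pi>"
    then obtain \<gamma> where \<gamma>: "\<pi> = (1 - omega) * \<gamma>" ..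
    \<comment> \<open>Primality forces \<pi> into the cofactor; cancelling \<gamma> would then make
      \<open>1 - omega\<close> a unit.\<close>
    have "\<pi> dvd \<gamma>"
      using prime_elem_dvd_multD[OF assms(1), of "1 - omega" \<gamma>]
        prime_elem_not_dvd_one_minus_omega[OF assms] \<gamma> by auto
    then have "(1 - omega) * \<gamma> dvd 1 * \<gamma>"
      using \<gamma> by simp
    moreover have "\<gamma> \<noteq> 0"
      using assms(1) \<gamma> by auto
    ultimately have "1 - omega dvd 1"
      using dvd_mult_cancel_right by blast
    then show False
      using one_minus_omega_dvd_iff[of 1] eis_norm_1 by simp
  qed
  then have "eis_norm \<pi> mod 3 \<noteq> 0"
    by (simp add: one_minus_omega_dvd_iff dvd_eq_mod_eq_0)
  obtain a b where \<pi>: "\<pi> = of_int a + of_int b * omega"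
    by (rule eisenstein_cases)
  have "eis_norm \<pi> = (a + b)^2 + 3 * (- (a * b))"
    unfolding \<pi> eis_norm_eq by (simp add: power2_eq_square algebra_simps)
  then have "eis_norm \<pi> mod 3 = ((a + b) mod 3)^2 mod 3"
    by (metis mod_mult_self2 power_mod)
  \<comment> \<open>The only nonzero square modulo 3 is 1.\<close>
  moreover have "(a + b) mod 3 = 0 \<or> (a + b) mod 3 = 1 \<or> (a + b) mod 3 = 2"
    by presburger
  ultimately show ?thesis
    using \<open>eis_norm \<pi> mod 3 \<noteq> 0\<close> by auto
qed

text \<open>Any difference of two distinct cube roots of unity is an associate of
  \<open>1 - omega\<close>, so \<pi> cannot divide it.\<close>

lemma dvd_diff_cube_roots_imp_eq:
  assumes "\<not> \<pi> dvd 1 - omega"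
    and "\<zeta> \<in> {1, omega, omega ^ 2}" and "\<xi> \<in> {1, omega, omega ^ 2}"
    and "\<pi> dvd \<zeta> - \<xi>"
  shows "\<zeta> = \<xi>"
proof -
  have "1 - omega = - (omega - 1)"
    "1 - omega = - omega * (1 - omega ^ 2)" "1 - omega = omega * (omega ^ 2 - 1)"
    "1 - omega = omega ^ 2 * (omega - omega ^ 2)" "1 - omega = - (omega ^ 2) * (omega ^ 2 - omega)"
    using omega_cube omega_power_mod_3[of 4]
    by (simp_all add: algebra_simps power2_eq_square power3_eq_cube power4_eq_xxxx)
  then have "\<not> \<pi> dvd omega - 1"
    "\<not> \<pi> dvd 1 - omega ^ 2" "\<not> \<pi> dvd omega ^ 2 - 1"
    "\<not> \<pi> dvd omega - omega ^ 2" "\<not> \<pi> dvd omega ^ 2 - omega"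
    using assms(1) by (metis dvd_minus_iff dvd_mult)+
  with assms show ?thesis
    by blast
qed

lemma cubic_residue_char_omega:
  assumes "prime_elem \<pi>" and "eis_norm \<pi> \<noteq> 3"
  shows "cubic_residue_char \<pi> omega = omega ^ nat ((eis_norm \<pi> - 1) div 3)"
proof -
  let ?\<xi> = "omega ^ nat ((eis_norm \<pi> - 1) div 3)"
  \<comment> \<open>A prime element does not divide a unit, which rules out the zero branch of the
    character.\<close>
  have "omega dvd 1"
    using omega_cube by (metis dvd_power zero_less_numeral)
  then have "\<not> \<pi> dvd omega"
    using assms(1) dvd_trans prime_elem_not_unit by blast
  moreover have "(THE \<zeta>. \<zeta> \<in> {1, omega, omega ^ 2} \<and> \<pi> dvd ?\<xi> - \<zeta>) = ?\<xi>"
  proof (rule the_equality)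
    show "?\<xi> \<in> {1, omega, omega ^ 2} \<and> \<pi> dvd ?\<xi> - ?\<xi>"
      using omega_power_in by simp
  next
    fix \<zeta> assume "\<zeta> \<in> {1, omega, omega ^ 2} \<and> \<pi> dvd ?\<xi> - \<zeta>"
    then show "\<zeta> = ?\<xi>"
      using dvd_diff_cube_roots_imp_eq[OF prime_elem_not_dvd_one_minus_omega[OF assms]
          omega_power_in] by metis
  qed
  ultimately show ?thesis
    by (simp add: cubic_residue_char_def)
qed

theorem theorem3p14:
  fixes \<pi> :: eisenstein
  assumes "prime_elem \<pi>" and "eis_norm \<pi> \<noteq> 3"
  shows "cubic_residue_char \<pi> omega = omega ^ nat ((eis_norm \<pi> - 1) div 3) \<and>
    ([eis_norm \<pi> = 1] (mod 9) \<and> cubic_residue_char \<pi> omega = 1 \<or>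
     [eis_norm \<pi> = 4] (mod 9) \<and> cubic_residue_char \<pi> omega = omega \<or>
     [eis_norm \<pi> = 7] (mod 9) \<and> cubic_residue_char \<pi> omega = omega ^ 2)"
proof -
  define k where "k = nat ((eis_norm \<pi> - 1) div 3)"
  have N: "eis_norm \<pi> = 3 * int k + 1"
  proof -
    \<comment> \<open>The division is exact and its result nonnegative, so \<open>nat\<close> loses
      nothing.\<close>
    have "eis_norm \<pi> = 3 * ((eis_norm \<pi> - 1) div 3) + 1" and "(eis_norm \<pi> - 1) div 3 \<ge> 0"
      using prime_elem_norm_mod_3[OF assms] eis_norm_nonneg[of \<pi>] by presburger+
    then show ?thesis
      unfolding k_def by simp
  qed
  have char: "cubic_residue_char \<pi> omega = omega ^ k"
    using cubic_residue_char_omega[OF assms] unfolding k_def .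
  \<comment> \<open>For \<open>k = 3 * m + r\<close> the norm is
    \<open>9 * m + 3 * r + 1\<close>.\<close>
  have "k mod 3 = 0 \<and> eis_norm \<pi> mod 9 = 1 \<or> k mod 3 = 1 \<and> eis_norm \<pi> mod 9 = 4 \<or>
      k mod 3 = 2 \<and> eis_norm \<pi> mod 9 = 7"
    unfolding N by presburger
  then have "[eis_norm \<pi> = 1] (mod 9) \<and> omega ^ k = 1 \<or>
      [eis_norm \<pi> = 4] (mod 9) \<and> omega ^ k = omega \<or>
      [eis_norm \<pi> = 7] (mod 9) \<and> omega ^ k = omega ^ 2"
    unfolding omega_power_mod_3[of k] cong_def by auto
  with char show ?thesis
    unfolding k_def by simp
qed

end
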